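(* Let $k\ge 1$ and $n\ge 1$ be integers and let $K_n$ be the complete graph on $n$ vertices. If the vertices of $K_n$ are colored uniformly and independently with $k$ colors, the expected number of blocks is $$\mathbb{E}[X_k(K_n)]=k-\frac{(k-1)^n}{k^{n-1}}.$$
   Context: Given a coloring of the vertices of a finite graph $G$ with $k$ colors, the blocks are the connected components of the subgraph of $G$ formed by all vertices and all edges whose two endpoints have the same color. $X_k(G)$ denotes the number of blocks when each vertex of $G$ receives independently a uniformly random color among $k$ colors. *)

theory Defs
  imports "HOL-Probability.Product_PMF" "Graph_Theory.Graph_Theory"
begin

text \<open>
  Graphs are symmetric digraphs: an undirected edge is a pair of opposite arcs, and
  \<^term>\<open>complete_digraph n G\<close> says that \<open>G\<close> is a simple graph that is
  complete on \<open>n\<close> vertices.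
\<close>

definition monochromatic_subgraph :: "('a, 'b) pre_digraph \<Rightarrow> ('a \<Rightarrow> 'c) \<Rightarrow> ('a, 'b) pre_digraph" where
  "monochromatic_subgraph G c =
     \<lparr> verts = verts G, arcs = {e \<in> arcs G. c (tail G e) = c (head G e)},
       tail = tail G, head = head G \<rparr>"

text \<open>
  \<open>connected\<close> is qualified because the topological notion has the same name. The graph
  without vertices is not connected, so every block has a vertex.
\<close>

definition blocks :: "('a, 'b) pre_digraph \<Rightarrow> ('a \<Rightarrow> 'c) \<Rightarrow> ('a, 'b) pre_digraph set" where
  "blocks G c =
     {H. pre_digraph.max_subgraph (monochromatic_subgraph G c) Digraph_Component.connected H}"

text \<open>The colors are \<open>0, \<dots>, k - 1\<close>; outside of the vertex set the coloring is constantly \<open>0\<close>.\<close>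

definition random_coloring :: "nat \<Rightarrow> ('a, 'b) pre_digraph \<Rightarrow> ('a \<Rightarrow> nat) pmf" where
  "random_coloring k G = Pi_pmf (verts G) 0 (\<lambda>_. pmf_of_set {..<k})"

definition expected_blocks :: "nat \<Rightarrow> ('a, 'b) pre_digraph \<Rightarrow> real" where
  "expected_blocks k G =
     measure_pmf.expectation (random_coloring k G) (\<lambda>c. real (card (blocks G c)))"

end

theory Submission
  imports Defs
begin

text \<open>
  Two vertices of a complete graph lie in the same block exactly when they have the same color, so
  the number of blocks is the number of colors that occur. By linearity of expectation its
  expectation is \<open>k\<close> times the probability \<open>1 - ((k - 1) / k) ^ n\<close> that a given color occurs.
\<close>

text \<open>\<open>subgraph\<close> includes \<open>compatible\<close>, which equates the whole
  \<open>tail\<close> and \<open>head\<close> functions, so two mutual subgraphs are equal as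
  records.\<close>

lemma subgraph_antisym:
  assumes "subgraph H H'" and "subgraph H' H"
  shows "H = H'"
  using assms by (auto simp: subgraph_def compatible_def intro!: pre_digraph.equality)

lemma wf_digraph_monochromatic_subgraph:
  assumes "wf_digraph G"
  shows "wf_digraph (monochromatic_subgraph G c)"
  using assms by (auto simp: wf_digraph_def monochromatic_subgraph_def)

text \<open>Every arc of the monochromatic subgraph preserves the color, and so does its reverse in
  the symmetric closure; induction along a path does the rest.\<close>

lemma connected_monochromatic:
  assumes sub: "subgraph H (monochromatic_subgraph G c)"
    and conn: "Digraph_Component.connected H"
    and "u \<in> verts H" and "v \<in> verts H"
  shows "c u = c v"
proof -
  have wf: "wf_digraph (with_proj (mk_symmetric H))"
    using sub
    by (auto simp: subgraph_def wf_digraph_wp_iff intro: wf_digraph.wellformed_mk_symmetric)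
  have step: "c x = c y" if "x \<rightarrow>\<^bsub>with_proj (mk_symmetric H)\<^esub> y" for x y
    using that sub
    by (fastforce simp: subgraph_def compatible_def monochromatic_subgraph_def mk_symmetric_def)
  have "u \<rightarrow>\<^sup>*\<^bsub>with_proj (mk_symmetric H)\<^esub> v"
    using conn assms(3,4)
    by (auto simp: Digraph_Component.connected_def strongly_connected_def mk_symmetric_def)
  then show ?thesis
    by (induction rule: wf_digraph.reachable_induct[OF wf, consumes 1]) (use step in auto)
qed

text \<open>These are the candidates for the blocks. A color that does not occur gives the graph
  without vertices, hence no block.\<close>

definition color_class :: "('a, 'b) pre_digraph \<Rightarrow> ('a \<Rightarrow> 'c) \<Rightarrow> 'c \<Rightarrow> ('a, 'b) pre_digraph" where
  "color_class G c i = monochromatic_subgraph G c \<restriction> {v \<in> verts G. c v = i}"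

lemma subgraph_color_class:
  assumes "wf_digraph G"
  shows "subgraph (color_class G c i) (monochromatic_subgraph G c)"
proof -
  interpret M: wf_digraph "monochromatic_subgraph G c"
    using assms by (rule wf_digraph_monochromatic_subgraph)
  show ?thesis
    unfolding color_class_def
    by (intro induced_imp_subgraph M.induced_induce) (auto simp: monochromatic_subgraph_def)
qed

text \<open>All vertices of \<open>H\<close> share the color of \<open>u\<close>, and the class,
  being induced, contains every arc between its vertices. This yields maximality in both directions
  below.\<close>

lemma connected_subgraph_color_class:
  assumes "wf_digraph G" and sub: "subgraph H (monochromatic_subgraph G c)"
    and conn: "Digraph_Component.connected H" and u: "u \<in> verts H"
  shows "subgraph H (color_class G c (c u))"
proof -
  have "verts H \<subseteq> {v \<in> verts G. c v = c u}"
    using connected_monochromatic[OF sub conn _ u] sub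
    by (auto simp: subgraph_def monochromatic_subgraph_def)
  moreover have "wf_digraph (color_class G c (c u))"
    using subgraph_color_class[OF assms(1), of c "c u"] by (simp add: subgraph_def)
  ultimately show ?thesis
    using sub unfolding subgraph_def color_class_def compatible_def
    by (auto dest: wf_digraph.tail_in_verts wf_digraph.head_in_verts)
qed

text \<open>Completeness enters here: distinct vertices of color \<open>i\<close> are joined by an
  arc of \<open>G\<close>, and this arc is monochromatic. That \<open>i\<close> occurs makes the
  class nonempty.\<close>

lemma connected_color_class:
  assumes "complete_digraph n G" and "i \<in> c ` verts G"
  shows "Digraph_Component.connected (color_class G c i)"
proof -
  have wfG: "wf_digraph G"
    using assms(1) by (auto simp: complete_digraph_def graph_def digraph_def fin_digraph_def)
  let ?S = "with_proj (mk_symmetric (color_class G c i))"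
  have "wf_digraph (color_class G c i)"
    using subgraph_color_class[OF wfG, of c i] by (simp add: subgraph_def)
  then interpret S: wf_digraph ?S
    by (auto intro: wf_digraph.wellformed_mk_symmetric wf_digraph_wp_iff[THEN iffD2])
  have verts: "verts ?S = {v \<in> verts G. c v = i}"
    by (simp add: mk_symmetric_def color_class_def)
  have "u \<rightarrow>\<^sup>*\<^bsub>?S\<^esub> v" if "u \<in> verts ?S" "v \<in> verts ?S" for u v
  proof (cases "u = v")
    case True
    then show ?thesis using that by simp
  next
    case False
    then have "(u, v) \<in> arcs_ends G"
      using that assms(1) unfolding verts by (auto simp: complete_digraph_def)
    then have "(u, v) \<in> arcs_ends ?S"
      using that unfolding verts
      by (fastforce simp: mk_symmetric_def color_class_def monochromatic_subgraph_def
          arcs_ends_def arc_to_ends_def)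
    then show ?thesis by (rule S.reachable_adjI)
  qed
  moreover have "verts ?S \<noteq> {}"
    using assms(2) unfolding verts by auto
  ultimately show ?thesis
    by (auto simp: Digraph_Component.connected_def)
qed

lemma blocks_complete_digraph:
  assumes "complete_digraph n G"
  shows "blocks G c = color_class G c ` c ` verts G"
proof -
  let ?M = "monochromatic_subgraph G c"
  have wfG: "wf_digraph G"
    using assms by (auto simp: complete_digraph_def graph_def digraph_def fin_digraph_def)
  show ?thesis
  proof (intro equalityI subsetI)
    fix H assume "H \<in> blocks G c"
    then have max: "pre_digraph.max_subgraph ?M Digraph_Component.connected H"
      by (simp add: blocks_def)
    then have sub: "subgraph H ?M" and conn: "Digraph_Component.connected H"
      by (auto simp: pre_digraph.max_subgraph_def)
    obtain u where u: "u \<in> verts H"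
      using conn by (auto simp: Digraph_Component.connected_def strongly_connected_def mk_symmetric_def)
    then have uG: "u \<in> verts G"
      using sub by (auto simp: subgraph_def monochromatic_subgraph_def)
    \<comment> \<open>The class of \<open>u\<close> is a connected subgraph containing
      \<open>H\<close>, so maximality of \<open>H\<close> forces equality.\<close>
    have "H = color_class G c (c u)"
      using max connected_subgraph_color_class[OF wfG sub conn u] subgraph_color_class[OF wfG]
        connected_color_class[OF assms, of "c u" c] uG
      unfolding pre_digraph.max_subgraph_def by (metis imageI)
    then show "H \<in> color_class G c ` c ` verts G"
      using uG by blast
  next
    fix H assume "H \<in> color_class G c ` c ` verts G"
    then obtain u where u: "u \<in> verts G" and H: "H = color_class G c (c u)" by blast
    have "H' = H" if "subgraph H H'" "subgraph H' ?M" "Digraph_Component.connected H'" for H'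
    proof (rule subgraph_antisym)
      have "u \<in> verts H'"
        using that(1) u by (auto simp: H subgraph_def color_class_def)
      then show "subgraph H' H"
        unfolding H by (rule connected_subgraph_color_class[OF wfG that(2,3)])
    qed fact
    then show "H \<in> blocks G c"
      using subgraph_color_class[OF wfG] connected_color_class[OF assms, of "c u" c] u
      by (auto simp: blocks_def pre_digraph.max_subgraph_def H)
  qed
qed

lemma card_blocks_complete_digraph:
  assumes "complete_digraph n G"
  shows "card (blocks G c) = card (c ` verts G)"
proof -
  \<comment> \<open>A class determines its color as the color of any of its vertices; the choice is
    sound because only occurring colors are considered.\<close>
  have "inj_on (color_class G c) (c ` verts G)"
    by (rule inj_on_inverseI[where g = "\<lambda>H. c (SOME v. v \<in> verts H)"])
      (auto simp: color_class_def intro: someI2)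
  then show ?thesis
    by (simp add: blocks_complete_digraph[OF assms] card_image)
qed

text \<open>Pass to the complement: \<open>i\<close> is missed when every element of
  \<open>A\<close> avoids it, and by independence this probability is a product of equal
  factors.\<close>

lemma prob_color_occurs:
  assumes "finite A" and "i < k"
  shows "measure_pmf.prob (Pi_pmf A d (\<lambda>_. pmf_of_set {..<k})) {c. i \<in> c ` A} =
    1 - ((real k - 1) / real k) ^ card A"
proof -
  have "{..<k} \<inter> - {i} = {..<k} - {i}" by auto
  then have "measure_pmf.prob (pmf_of_set {..<k}) (- {i}) = (real k - 1) / real k"
    using assms(2) by (subst measure_pmf_of_set) (auto simp: of_nat_diff lessThan_empty_iff)
  moreover have "{c. i \<in> c ` A} = UNIV - Pi A (\<lambda>_. - {i})"
    by auto
  ultimately show ?thesis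
    using measure_pmf.prob_compl[of "Pi A (\<lambda>_. - {i})" "Pi_pmf A d (\<lambda>_. pmf_of_set {..<k})"]
    by (simp add: measure_Pi_pmf_Pi[OF assms(1)])
qed

lemma expectation_card_colors:
  assumes "finite A" and "k \<ge> 1"
  shows "measure_pmf.expectation (Pi_pmf A d (\<lambda>_. pmf_of_set {..<k})) (\<lambda>c. real (card (c ` A))) =
    real k * (1 - ((real k - 1) / real k) ^ card A)"
proof -
  let ?p = "Pi_pmf A d (\<lambda>_. pmf_of_set {..<k})"
  \<comment> \<open>Summing indicators over \<open>i<k\<close> counts all occurring colors only if
    none is \<open>k\<close> or larger, so the identity below is proved on the support
    alone.\<close>
  have supp: "c ` A \<subseteq> {..<k}" if "c \<in> set_pmf ?p" for c
    using that assms by (auto simp: set_Pi_pmf PiE_dflt_def lessThan_empty_iff)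
  have "measure_pmf.expectation ?p (\<lambda>c. real (card (c ` A))) =
      measure_pmf.expectation ?p (\<lambda>c. \<Sum>i<k. indicator {c. i \<in> c ` A} c)"
  proof (intro integral_cong_AE AE_pmfI)
    fix c assume "c \<in> set_pmf ?p"
    then have "{i \<in> {..<k}. i \<in> c ` A} = c ` A"
      using supp by blast
    then show "real (card (c ` A)) = (\<Sum>i<k. indicator {c. i \<in> c ` A} c)"
      by (simp add: indicator_def sum.If_cases Int_def)
  qed auto
  also have "\<dots> = (\<Sum>i<k. measure_pmf.prob ?p {c. i \<in> c ` A})"
    by (subst Bochner_Integration.integral_sum)
      (auto intro!: measure_pmf.integrable_const_bound[where B = 1] simp: indicator_def)
  also have "\<dots> = real k * (1 - ((real k - 1) / real k) ^ card A)"
    by (simp add: prob_color_occurs[OF assms(1)])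
  finally show ?thesis .
qed

theorem corollary4p2:
  fixes k n :: nat and G :: "('a, 'b) pre_digraph"
  assumes "k \<ge> 1" and "n \<ge> 1" and "complete_digraph n G"
  shows "expected_blocks k G = real k - (real k - 1) ^ n / real k ^ (n - 1)"
proof -
  have "card (verts G) = n"
    using assms(3) by (simp add: complete_digraph_def)
  \<comment> \<open>Infinite sets have \<open>card\<close> equal to 0, so positive cardinality gives
    finiteness.\<close>
  moreover from this have "finite (verts G)"
    using assms(2) by (intro card_ge_0_finite) simp
  ultimately have "expected_blocks k G = real k * (1 - ((real k - 1) / real k) ^ n)"
    using assms(1)
    by (simp add: expected_blocks_def random_coloring_def expectation_card_colors
        card_blocks_complete_digraph[OF assms(3)])
  \<comment> \<open>As \<open>n\<close> is positive, \<open>n - 1\<close> is not truncated, and the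
    factor \<open>k\<close> cancels one power in the denominator.\<close>
  also have "real k ^ n = real k * real k ^ (n - 1)"
    using assms(2) by (simp add: power_eq_if)
  then have "real k * (1 - ((real k - 1) / real k) ^ n) =
      real k - (real k - 1) ^ n / real k ^ (n - 1)"
    using assms(1) by (simp add: power_divide field_simps)
  finally show ?thesis .
qed

end
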